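(* Let $K=(X,\delta,m)$ be a cell complex. Suppose $F(x)\ge R>0$ for all $x\in X_1$. Then $$\operatorname{diam}\le\frac{2\min(D_1,D_0)}{R}.$$
   Context: For a finite set $X$, $C(X)=\mathbb{R}^X$, and $x\in X$ is identified with its indicator function $1_x\in C(X)$. A cell complex $K=(X,\delta,m)$ consists of a finite set of cells $X=\dot\bigcup_{k\ge 0}X_k$, a linear operator $\delta:C(X)\to C(X)$ (coboundary) and a weight $m:X\to(0,\infty)$. Write $\dim(z)=k$ iff $z\in X_k$, and $x\lessdot z$ (equivalently $z\gtrdot x$) iff $\delta x(z)\ne 0$. It is required that for all $v,z,z'\in X$: $\delta v(z)\in\{-1,0,1\}$; $\delta v(z)=0$ if $\dim(z)-\dim(v)\ne 1$; if $\dim(z)\ge 1$ there exists $x\lessdot z$; and (i) for every $x\in X_1$ there is exactly one $w\in X_0$ with $\delta w(x)=1$ and exactly one $w\in X_0$ with $\delta w(x)=-1$; (ii) if $\dim(z)-\dim(v)=2$ and $\{x:v\lessdot x\lessdot z\}\ne\emptyset$, then $|\{x:v\lessdot x\lessdot z\}|=2$ and $\{\delta v(x)\,\delta x(z):x\in X\}\supseteq\{-1,1\}$ (hence $\delta\delta=0$); (iii) for all $x,y\lessdot z$ there is a sequence $(x=x_0,\dots,x_n=y)$ of cells with $\delta x_i(x_{i-1})+\delta x_{i-1}(x_i)\ne0$ for all $i=1,\dots,n$; (iv) if $\{x:x\lessdot z\}=\{x:x\lessdot z'\}$ and $\dim(z)\ge 1$, then $z=z'$. $C(X)$ carries the scalar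 product $\langle f,g\rangle=\sum_{x\in X}f(x)g(x)m(x)$, $\delta^*$ is the adjoint of $\delta$, and $H=\delta\delta^*+\delta^*\delta$ is the Hodge Laplacian. The Forman curvature of $x\in X$ is $F(x)=Hx(x)-\sum_{y\ne x}|Hy(x)|$. For $v,w\in X_0$, $v\sim w$ iff there is $x\in X_1$ with $v,w\lessdot x$; $d(v,w)=\inf\{n: v=v_0\sim v_1\sim\dots\sim v_n=w,\ v_i \in X_0\}$ is the combinatorial path distance and $\operatorname{diam}=\max_{v,w\in X_0}d(v,w)$. For $x\in X$, $$\operatorname{Deg}(x)=\sum_{z\gtrdot x}\frac{m(z)}{m(x)}+\max_{v\lessdot x}\frac{m(x)}{m(v)},$$ where the maximum is set to be $0$ if $x\in X_0$, and $D_k=\max_{x\in X_k}\operatorname{Deg}(x)$.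
   Formalization: The diameter bound is stated for cell complexes in which all vertex distances are finite (connected); without this it fails, e.g. for two disjoint unit-weight edges (F=2, D_0=D_1=1, diam infinite). In general the bound is stated for every finite distance d(v,w). *)

theory Defs
  imports "HOL-Analysis.Analysis"
begin

text \<open>
  The cells are the elements of a finite type, so that \<open>C(X)\<close> is the vector space
  \<open>real ^ 'a\<close> and the indicator function of a cell \<open>x\<close> is \<open>axis x 1\<close>.
\<close>

record ('a :: finite) cell_data =
  cdim :: "'a \<Rightarrow> nat"
  cobd :: "real ^ 'a \<Rightarrow> real ^ 'a"
  weight :: "'a \<Rightarrow> real"

abbreviation cell_ind :: "'a :: finite \<Rightarrow> real ^ 'a" where
  "cell_ind x \<equiv> axis x 1"

definition cells :: "'a :: finite cell_data \<Rightarrow> nat \<Rightarrow> 'a set" where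
  "cells K k = {x. cdim K x = k}"

text \<open>The matrix entry \<open>\<delta>x(z)\<close> of the coboundary operator.\<close>

definition inc :: "'a :: finite cell_data \<Rightarrow> 'a \<Rightarrow> 'a \<Rightarrow> real" where
  "inc K x z = cobd K (cell_ind x) $ z"

definition covered :: "'a :: finite cell_data \<Rightarrow> 'a \<Rightarrow> 'a \<Rightarrow> bool" where
  "covered K x z \<longleftrightarrow> inc K x z \<noteq> 0"

definition cell_complex :: "'a :: finite cell_data \<Rightarrow> bool" where
  "cell_complex K \<longleftrightarrow>
     linear (cobd K) \<and>
     (\<forall>x. weight K x > 0) \<and>
     (\<forall>v z. inc K v z \<in> {-1, 0, 1}) \<and>
     (\<forall>v z. int (cdim K z) - int (cdim K v) \<noteq> 1 \<longrightarrow> inc K v z = 0) \<and>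
     (\<forall>z. cdim K z \<ge> 1 \<longrightarrow> (\<exists>x. covered K x z)) \<and>
     (\<forall>x\<in>cells K 1. (\<exists>!w. w \<in> cells K 0 \<and> inc K w x = 1) \<and>
                    (\<exists>!w. w \<in> cells K 0 \<and> inc K w x = -1)) \<and>
     (\<forall>v z. int (cdim K z) - int (cdim K v) = 2 \<and>
            {x. covered K v x \<and> covered K x z} \<noteq> {} \<longrightarrow>
            card {x. covered K v x \<and> covered K x z} = 2 \<and>
            {-1, 1} \<subseteq> {inc K v x * inc K x z |x. True}) \<and>
     (\<forall>z x y. covered K x z \<and> covered K y z \<longrightarrow>
        (\<exists>n (c :: nat \<Rightarrow> 'a). c 0 = x \<and> c n = y \<and>
           (\<forall>i\<in>{1..n}. inc K (c i) (c (i - 1)) + inc K (c (i - 1)) (c i) \<noteq> 0))) \<and>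
     (\<forall>z z'. {x. covered K x z} = {x. covered K x z'} \<and> cdim K z \<ge> 1 \<longrightarrow> z = z')"

definition wprod :: "'a :: finite cell_data \<Rightarrow> real ^ 'a \<Rightarrow> real ^ 'a \<Rightarrow> real" where
  "wprod K f g = (\<Sum>x\<in>UNIV. f $ x * g $ x * weight K x)"

definition cobd_adj :: "'a :: finite cell_data \<Rightarrow> real ^ 'a \<Rightarrow> real ^ 'a" where
  "cobd_adj K = (THE D. \<forall>f g. wprod K (cobd K f) g = wprod K f (D g))"

lemma wprod_cell_ind: "wprod K (cell_ind x) g = g $ x * weight K x"
proof -
  have "wprod K (cell_ind x) g = (\<Sum>y\<in>UNIV. if y = x then g $ x * weight K x else 0)"
    unfolding wprod_def by (rule sum.cong) (auto simp: axis_def)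
  then show ?thesis by simp
qed

text \<open>The adjoint is well defined.\<close>

lemma cobd_adj_ex1:
  assumes "linear (cobd K)" and pos: "\<forall>x. weight K x > 0"
  shows "\<exists>!D. \<forall>f g. wprod K (cobd K f) g = wprod K f (D g)"
proof (rule ex_ex1I)
  let ?D = "\<lambda>g. \<chi> x. (\<Sum>z\<in>UNIV. inc K x z * g $ z * weight K z) / weight K x"
  have cobd_expand: "cobd K f $ z = (\<Sum>x\<in>UNIV. f $ x * inc K x z)" for f z
  proof -
    have "cobd K f = cobd K (\<Sum>x\<in>UNIV. f $ x *\<^sub>R cell_ind x)"
      by (simp add: basis_expansion scalar_mult_eq_scaleR[symmetric])
    also have "\<dots> = (\<Sum>x\<in>UNIV. f $ x *\<^sub>R cobd K (cell_ind x))"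
      by (simp add: linear_sum[OF assms(1)] linear_cmul[OF assms(1)])
    finally show ?thesis by (simp add: inc_def)
  qed
  have "wprod K (cobd K f) g = wprod K f (?D g)" for f g
  proof -
    have "wprod K (cobd K f) g =
        (\<Sum>z\<in>UNIV. \<Sum>x\<in>UNIV. f $ x * inc K x z * g $ z * weight K z)"
      by (simp add: wprod_def cobd_expand sum_distrib_right)
    also have "\<dots> = (\<Sum>x\<in>UNIV. \<Sum>z\<in>UNIV. f $ x * inc K x z * g $ z * weight K z)"
      by (rule sum.swap)
    also have "\<dots> = (\<Sum>x\<in>UNIV. f $ x * (\<Sum>z\<in>UNIV. inc K x z * g $ z * weight K z))"
      by (simp add: sum_distrib_left mult.assoc)
    also have "\<dots> = wprod K f (?D g)"
      unfolding wprod_def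
    proof (rule sum.cong)
      show "f $ x * (\<Sum>z\<in>UNIV. inc K x z * g $ z * weight K z) = f $ x * ?D g $ x * weight K x" for x
        using pos[rule_format, of x] by simp
    qed simp
    finally show ?thesis .
  qed
  then show "\<exists>D. \<forall>f g. wprod K (cobd K f) g = wprod K f (D g)"
    by (intro exI[of _ ?D] allI)
next
  fix D E
  assume D: "\<forall>f g. wprod K (cobd K f) g = wprod K f (D g)"
    and E: "\<forall>f g. wprod K (cobd K f) g = wprod K f (E g)"
  show "D = E"
  proof
    fix g
    have "D g $ x * weight K x = E g $ x * weight K x" for x
      using D E by (metis wprod_cell_ind)
    moreover have "weight K x \<noteq> 0" for x
      using pos by (metis less_irrefl)
    ultimately show "D g = E g"
      by (simp add: vec_eq_iff)
  qed
qed

lemma cobd_adj: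
  assumes "cell_complex K"
  shows "wprod K (cobd K f) g = wprod K f (cobd_adj K g)"
proof -
  have "linear (cobd K)" "\<forall>x. weight K x > 0"
    using assms by (simp_all add: cell_complex_def)
  from theI'[OF cobd_adj_ex1[OF this]] show ?thesis
    unfolding cobd_adj_def by blast
qed

definition hodge :: "'a :: finite cell_data \<Rightarrow> real ^ 'a \<Rightarrow> real ^ 'a" where
  "hodge K f = cobd K (cobd_adj K f) + cobd_adj K (cobd K f)"

definition forman :: "'a :: finite cell_data \<Rightarrow> 'a \<Rightarrow> real" where
  "forman K x = hodge K (cell_ind x) $ x
     - (\<Sum>y\<in>UNIV - {x}. \<bar>hodge K (cell_ind y) $ x\<bar>)"

definition adj :: "'a :: finite cell_data \<Rightarrow> 'a \<Rightarrow> 'a \<Rightarrow> bool" where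
  "adj K v w \<longleftrightarrow> (\<exists>x\<in>cells K 1. covered K v x \<and> covered K w x)"

text \<open>
  The infimum is taken in \<open>enat\<close>, so vertices which no path joins have distance \<open>\<infinity>\<close>.
\<close>

definition path_dist :: "'a :: finite cell_data \<Rightarrow> 'a \<Rightarrow> 'a \<Rightarrow> enat" where
  "path_dist K v w = Inf {enat n |n. \<exists>c :: nat \<Rightarrow> 'a. c 0 = v \<and> c n = w \<and>
     (\<forall>i\<le>n. c i \<in> cells K 0) \<and> (\<forall>i<n. adj K (c i) (c (Suc i)))}"

definition diam :: "'a :: finite cell_data \<Rightarrow> enat" where
  "diam K = Max {path_dist K v w |v w. v \<in> cells K 0 \<and> w \<in> cells K 0}"

definition Deg :: "'a :: finite cell_data \<Rightarrow> 'a \<Rightarrow> real" where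
  "Deg K x = (\<Sum>z\<in>{z. covered K x z}. weight K z / weight K x)
     + (if x \<in> cells K 0 then 0 else Max {weight K x / weight K v |v. covered K v x})"

text \<open>
  The maximum over an empty set of cells is set to \<open>0\<close>; for \<open>k \<le> 1\<close> this only matters
  for \<open>k = 1\<close> and a complex that consists of isolated vertices.
\<close>

definition maxDeg :: "'a :: finite cell_data \<Rightarrow> nat \<Rightarrow> real" where
  "maxDeg K k = (if cells K k = {} then 0 else Max (Deg K ` cells K k))"

end

theory Submission
  imports Defs
begin

text \<open>
  For \<open>\<bar>\<phi>\<bar> \<le> 1\<close> with \<open>\<phi>(x) = \<plusminus>1\<close>, the Forman curvature satisfies \<open>F(x) \<le> \<phi>(x) H\<phi>(x)\<close>.
  Let \<open>f = min(d(v, \<cdot>), L)\<close> with \<open>L = d(v, w)\<close> and \<open>U = \<delta>\<^sup>*\<delta>f\<close>. Taking \<open>\<phi> = \<delta>f\<close> on the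
  edges of a geodesic from \<open>v\<close> to \<open>w\<close>, the identity \<open>\<delta>\<delta> = 0\<close> leaves \<open>H\<phi> = \<delta>U\<close>, which telescopes to
  \<open>R L \<le> U(w) - U(v) \<le> 2 D\<^sub>0\<close>. For the bound by \<open>D\<^sub>1\<close>, on the first edge \<open>x\<close> one instead sets \<open>\<phi>\<close>
  to zero on all other edges at \<open>v\<close>; as every 2-cell above \<open>x\<close> contains exactly one of
  these, \<open>-U(v)\<close> is replaced by at most \<open>Deg(x)\<close>, and similarly at \<open>w\<close>.
\<close>

section \<open>Incidence numbers\<close>

context
  fixes K :: "'a :: finite cell_data"
  assumes K: "cell_complex K"
begin

lemma linear_cobd: "linear (cobd K)"
  using K by (simp add: cell_complex_def)

lemma weight_pos: "weight K x > 0"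
  using K by (simp add: cell_complex_def)

lemma weight_nz: "weight K x \<noteq> 0"
  using weight_pos[of x] by simp

lemma inc_cases: "inc K v z = -1 \<or> inc K v z = 0 \<or> inc K v z = 1"
proof -
  have "\<forall>v z. inc K v z \<in> {-1, 0, 1}"
    using K unfolding cell_complex_def by blast
  then show ?thesis by blast
qed

lemma abs_inc: "\<bar>inc K v z\<bar> = (if covered K v z then 1 else 0)"
  using inc_cases[of v z] by (auto simp: covered_def)

lemma inc_mult_self: "inc K v z * inc K v z = (if covered K v z then 1 else 0)"
  using inc_cases[of v z] by (auto simp: covered_def)

lemma covered_dim:
  assumes "covered K v z" shows "cdim K z = Suc (cdim K v)"
proof -
  have "\<forall>v z. int (cdim K z) - int (cdim K v) \<noteq> 1 \<longrightarrow> inc K v z = 0"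
    using K unfolding cell_complex_def by blast
  then have "int (cdim K z) - int (cdim K v) = 1"
    using assms unfolding covered_def by blast
  then show ?thesis by simp
qed

text \<open>Descending from any cell to a face lowers the dimension by one until a vertex is
  reached. This makes the set whose maximum is \<open>diam K\<close> nonempty.\<close>

lemma vertex_exists: "cells K 0 \<noteq> {}"
proof -
  have ex: "\<forall>z. cdim K z \<ge> 1 \<longrightarrow> (\<exists>x. covered K x z)"
    using K unfolding cell_complex_def by blast
  have "cells K 0 \<noteq> {}" if "cdim K z = n" for n z
    using that
  proof (induction n arbitrary: z)
    case 0
    then show ?case by (auto simp: cells_def)
  next
    case (Suc n)
    then obtain x where "covered K x z" using ex by fastforce
    then have "cdim K x = n" using covered_dim Suc.prems by simp
    then show ?case by (rule Suc.IH)
  qed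
  then show ?thesis by blast
qed

lemma between_card:
  assumes "covered K v x" "covered K x z"
  shows "card {y. covered K v y \<and> covered K y z} = 2"
    and "{-1, 1} \<subseteq> {inc K v y * inc K y z |y. True}"
proof -
  have "int (cdim K z) - int (cdim K v) = 2"
    using covered_dim[OF assms(1)] covered_dim[OF assms(2)] by simp
  moreover have "{y. covered K v y \<and> covered K y z} \<noteq> {}" using assms by blast
  moreover have "\<forall>v z. int (cdim K z) - int (cdim K v) = 2 \<and>
            {x. covered K v x \<and> covered K x z} \<noteq> {} \<longrightarrow>
            card {x. covered K v x \<and> covered K x z} = 2 \<and>
            {-1, 1} \<subseteq> {inc K v x * inc K x z |x. True}"
    using K unfolding cell_complex_def by blast
  ultimately show "card {y. covered K v y \<and> covered K y z} = 2"
    and "{-1, 1} \<subseteq> {inc K v y * inc K y z |y. True}" by blast+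
qed

text \<open>This is \<delta>\<delta> = 0 entrywise: the cells between \<open>v\<close> and
  \<open>z\<close> are none, or exactly two with products -1 and 1, which cancel.\<close>

lemma sum_inc_inc: "(\<Sum>x\<in>UNIV. inc K v x * inc K x z) = 0"
proof (cases "\<exists>x. covered K v x \<and> covered K x z")
  case False
  then show ?thesis by (intro sum.neutral) (auto simp: covered_def)
next
  case True
  then obtain x where "covered K v x" "covered K x z" by blast
  note P = between_card[OF this]
  let ?P = "{y. covered K v y \<and> covered K y z}"
  obtain p where p: "inc K v p * inc K p z = -1" using P(2) by auto
  obtain q where q: "inc K v q * inc K q z = 1" using P(2) by auto
  have pq: "p \<in> ?P" "q \<in> ?P" "p \<noteq> q" using p q by (auto simp: covered_def)
  then have "{p, q} = ?P"
    using P(1) by (intro card_subset_eq) auto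
  moreover have "(\<Sum>x\<in>UNIV. inc K v x * inc K x z) = (\<Sum>x\<in>?P. inc K v x * inc K x z)"
    by (rule sum.mono_neutral_right) (auto simp: covered_def)
  ultimately show ?thesis using p q pq(3) by (metis (lifting) sum.insert sum.empty finite.intros
      add.right_neutral add.left_inverse singletonD empty_iff)
qed

lemma edge_oriented:
  assumes "x \<in> cells K 1"
  shows "\<exists>!w. w \<in> cells K 0 \<and> inc K w x = 1" and "\<exists>!w. w \<in> cells K 0 \<and> inc K w x = -1"
proof -
  have "\<forall>x\<in>cells K 1. (\<exists>!w. w \<in> cells K 0 \<and> inc K w x = 1) \<and> (\<exists>!w. w \<in> cells K 0 \<and> inc K w x = -1)"
    using K unfolding cell_complex_def by (elim conjE)
  then show "\<exists>!w. w \<in> cells K 0 \<and> inc K w x = 1" and "\<exists>!w. w \<in> cells K 0 \<and> inc K w x = -1"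
    using assms by blast+
qed

text \<open>Each sign occurs at exactly one vertex of an edge, so distinct endpoints carry opposite
  signs and leave no room for a third.\<close>

lemma edge_ends:
  assumes "x \<in> cells K 1" "covered K a x" "covered K b x" "a \<noteq> b"
  shows "{v. covered K v x} = {a, b}" and "inc K a x = - inc K b x"
proof -
  have dim0: "v \<in> cells K 0" if "covered K v x" for v
    using covered_dim[OF that] assms(1) by (simp add: cells_def)
  note ex = edge_oriented[OF assms(1)]
  have uniq: "v = w" if "covered K v x" "inc K v x = inc K w x" for v w
    using ex inc_cases[of v x] that dim0[of v] dim0[of w] unfolding covered_def by (metis (full_types))
  have vals: "inc K v x = 1 \<or> inc K v x = -1" if "covered K v x" for v
    using inc_cases[of v x] that by (auto simp: covered_def)
  show "inc K a x = - inc K b x"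
    using vals[OF assms(2)] vals[OF assms(3)] uniq[of a b] assms by auto
  then show "{v. covered K v x} = {a, b}"
    using vals uniq assms(2,3) by (auto) (metis minus_equation_iff)
qed

text \<open>Two edges joining the same distinct vertices have the same faces, and a cell of positive
  dimension is determined by its faces: there are no multiple edges.\<close>

lemma edge_unique:
  assumes "x \<in> cells K 1" "covered K a x" "covered K b x" "a \<noteq> b"
    and "covered K a y" "covered K b y"
  shows "y = x"
proof -
  have "cdim K y = cdim K x"
    using covered_dim[OF assms(2)] covered_dim[OF assms(5)] by simp
  then have y: "y \<in> cells K 1" using assms(1) by (simp add: cells_def)
  have "{v. covered K v x} = {v. covered K v y}"
    using edge_ends(1)[OF assms(1-4)] edge_ends(1)[OF y assms(5,6,4)] by simp
  moreover have "\<forall>z z'. {x. covered K x z} = {x. covered K x z'} \<and> cdim K z \<ge> 1 \<longrightarrow> z = z'"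
    using K unfolding cell_complex_def by blast
  moreover have "cdim K y \<ge> 1" using y by (simp add: cells_def)
  ultimately show ?thesis by (metis (lifting))
qed

section \<open>The Hodge Laplacian and the Forman curvature\<close>

lemma cobd_nth: "cobd K f $ z = (\<Sum>x\<in>UNIV. f $ x * inc K x z)"
proof -
  have "cobd K f = cobd K (\<Sum>x\<in>UNIV. f $ x *\<^sub>R cell_ind x)"
    by (simp add: basis_expansion scalar_mult_eq_scaleR[symmetric])
  also have "\<dots> = (\<Sum>x\<in>UNIV. f $ x *\<^sub>R cobd K (cell_ind x))"
    by (simp add: linear_sum[OF linear_cobd] linear_cmul[OF linear_cobd])
  finally show ?thesis by (simp add: inc_def)
qed

lemma cobd_cobd: "cobd K (cobd K f) = 0"
proof (rule vec_eq_iff[THEN iffD2], rule allI)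
  fix z
  have "cobd K (cobd K f) $ z = (\<Sum>x\<in>UNIV. \<Sum>v\<in>UNIV. f $ v * (inc K v x * inc K x z))"
    by (simp add: cobd_nth sum_distrib_right mult.assoc)
  also have "\<dots> = (\<Sum>v\<in>UNIV. f $ v * (\<Sum>x\<in>UNIV. inc K v x * inc K x z))"
    by (subst sum.swap) (simp add: sum_distrib_left)
  finally show "cobd K (cobd K f) $ z = 0 $ z" by (simp add: sum_inc_inc)
qed

lemma cobd_adj_nth:
  "cobd_adj K g $ x = (\<Sum>z\<in>UNIV. inc K x z * g $ z * (weight K z / weight K x))"
proof -
  have "cobd_adj K g $ x * weight K x = wprod K (cobd K (cell_ind x)) g"
    by (simp add: cobd_adj[OF K] wprod_cell_ind)
  also have "\<dots> = (\<Sum>z\<in>UNIV. inc K x z * g $ z * weight K z)"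
    by (simp add: wprod_def inc_def)
  finally show ?thesis
    using weight_nz[of x] by (simp add: sum_divide_distrib[symmetric] field_simps)
qed

lemma linear_cobd_adj: "linear (cobd_adj K)"
  by (rule linearI)
    (simp_all add: vec_eq_iff cobd_adj_nth algebra_simps sum.distrib sum_distrib_left add_divide_distrib)

lemma linear_hodge: "linear (hodge K)"
proof -
  have "linear (\<lambda>f. (cobd K \<circ> cobd_adj K) f + (cobd_adj K \<circ> cobd K) f)"
    by (intro linear_compose_add linear_compose linear_cobd linear_cobd_adj)
  then show ?thesis by (simp add: hodge_def[abs_def] o_def)
qed

text \<open>Expand H\<phi>(x) over the indicators: the diagonal coefficient is \<phi>(x)^2 = 1, and
  each off-diagonal entry has a coefficient of modulus at most 1, so it costs at most its absolute
  value.\<close>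

lemma forman_le_hodge:
  assumes le: "\<And>y. \<bar>\<phi> $ y\<bar> \<le> 1" and one: "\<bar>\<phi> $ x\<bar> = 1"
  shows "forman K x \<le> \<phi> $ x * hodge K \<phi> $ x"
proof -
  have "hodge K \<phi> = hodge K (\<Sum>y\<in>UNIV. \<phi> $ y *\<^sub>R cell_ind y)"
    by (simp add: basis_expansion scalar_mult_eq_scaleR[symmetric])
  also have "\<dots> = (\<Sum>y\<in>UNIV. \<phi> $ y *\<^sub>R hodge K (cell_ind y))"
    by (simp add: linear_sum[OF linear_hodge] linear_cmul[OF linear_hodge])
  finally have "\<phi> $ x * hodge K \<phi> $ x = (\<Sum>y\<in>UNIV. \<phi> $ x * \<phi> $ y * hodge K (cell_ind y) $ x)"
    by (simp add: sum_distrib_left mult.assoc)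
  also have "\<dots> = \<phi> $ x * \<phi> $ x * hodge K (cell_ind x) $ x
      + (\<Sum>y\<in>UNIV - {x}. \<phi> $ x * \<phi> $ y * hodge K (cell_ind y) $ x)"
    by (rule sum.remove) auto
  also have "\<phi> $ x * \<phi> $ x = 1"
    using one by (metis abs_mult_self_eq mult_1)
  finally have eq: "\<phi> $ x * hodge K \<phi> $ x = hodge K (cell_ind x) $ x
      + (\<Sum>y\<in>UNIV - {x}. \<phi> $ x * \<phi> $ y * hodge K (cell_ind y) $ x)" by simp
  have "(\<Sum>y\<in>UNIV - {x}. - \<bar>hodge K (cell_ind y) $ x\<bar>)
      \<le> (\<Sum>y\<in>UNIV - {x}. \<phi> $ x * \<phi> $ y * hodge K (cell_ind y) $ x)"
  proof (rule sum_mono)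
    fix y
    have "\<bar>\<phi> $ x * \<phi> $ y * hodge K (cell_ind y) $ x\<bar> \<le> 1 * \<bar>hodge K (cell_ind y) $ x\<bar>"
      unfolding abs_mult one using le[of y] by (intro mult_right_mono) auto
    then show "- \<bar>hodge K (cell_ind y) $ x\<bar> \<le> \<phi> $ x * \<phi> $ y * hodge K (cell_ind y) $ x"
      by linarith
  qed
  then show ?thesis unfolding forman_def eq by (simp add: sum_negf)
qed

section \<open>Degrees and pointwise bounds for the adjoint\<close>

lemma up_degree_eq:
  "(\<Sum>z\<in>{z. covered K x z}. weight K z / weight K x)
    = (\<Sum>z\<in>UNIV. \<bar>inc K x z\<bar> * (weight K z / weight K x))"
proof -
  have "(\<Sum>z\<in>UNIV. \<bar>inc K x z\<bar> * (weight K z / weight K x))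
    = (\<Sum>z\<in>{z. covered K x z}. \<bar>inc K x z\<bar> * (weight K z / weight K x))"
    by (rule sum.mono_neutral_right) (auto simp: covered_def)
  also have "\<dots> = (\<Sum>z\<in>{z. covered K x z}. weight K z / weight K x)"
    by (rule sum.cong) (auto simp: abs_inc)
  finally show ?thesis by simp
qed

lemma up_degree_nonneg: "0 \<le> (\<Sum>z\<in>{z. covered K x z}. weight K z / weight K x)"
  by (intro sum_nonneg divide_nonneg_nonneg less_imp_le weight_pos)

lemma abs_cobd_adj_le:
  assumes "\<And>z. covered K x z \<Longrightarrow> \<bar>g $ z\<bar> \<le> 1"
  shows "\<bar>cobd_adj K g $ x\<bar> \<le> (\<Sum>z\<in>{z. covered K x z}. weight K z / weight K x)"
proof -
  have "\<bar>cobd_adj K g $ x\<bar> \<le> (\<Sum>z\<in>UNIV. \<bar>inc K x z * g $ z * (weight K z / weight K x)\<bar>)"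
    unfolding cobd_adj_nth by (rule sum_abs)
  also have "\<dots> \<le> (\<Sum>z\<in>UNIV. \<bar>inc K x z\<bar> * (weight K z / weight K x))"
  proof (rule sum_mono)
    fix z
    have "\<bar>inc K x z\<bar> * \<bar>g $ z\<bar> \<le> \<bar>inc K x z\<bar>"
      using assms[of z] by (auto simp: abs_inc)
    then have "\<bar>inc K x z\<bar> * \<bar>g $ z\<bar> * (weight K z / weight K x)
        \<le> \<bar>inc K x z\<bar> * (weight K z / weight K x)"
      using weight_pos[of z] weight_pos[of x] by (intro mult_right_mono) auto
    then show "\<bar>inc K x z * g $ z * (weight K z / weight K x)\<bar> \<le> \<bar>inc K x z\<bar> * (weight K z / weight K x)"
      using weight_pos[of z] weight_pos[of x] by (simp add: abs_mult)
  qed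
  finally show ?thesis by (simp only: up_degree_eq)
qed

lemma Deg_vertex:
  "a \<in> cells K 0 \<Longrightarrow> Deg K a = (\<Sum>z\<in>{z. covered K a z}. weight K z / weight K a)"
  by (simp add: Deg_def)

lemma Deg_edge_ge:
  assumes "x \<in> cells K 1" "covered K a x"
  shows "weight K x / weight K a + (\<Sum>z\<in>{z. covered K x z}. weight K z / weight K x) \<le> Deg K x"
proof -
  have "weight K x / weight K a \<le> Max {weight K x / weight K v |v. covered K v x}"
    using assms(2) by (intro Max_ge) auto
  then show ?thesis using assms(1) by (simp add: Deg_def cells_def)
qed

section \<open>Curvature estimates on a single edge\<close>

lemma cobd_edge:
  assumes "x \<in> cells K 1" "covered K a x" "covered K b x" "a \<noteq> b"
  shows "cobd K f $ x = inc K b x * (f $ b - f $ a)"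
proof -
  have "cobd K f $ x = (\<Sum>v\<in>{v. covered K v x}. f $ v * inc K v x)"
    unfolding cobd_nth by (rule sum.mono_neutral_right) (auto simp: covered_def)
  then show ?thesis
    using edge_ends[OF assms] assms(4) by (simp add: algebra_simps)
qed

text \<open>Test with \<phi> = \<delta>f. As \<delta>\<delta> = 0, only the gradient of
  \<open>cobd_adj K (cobd K f)\<close> survives, and the orientation sign of \<open>x\<close> enters
  squared. The resulting difference telescopes along a path.\<close>

lemma forman_le_cobd_laplacian:
  assumes x: "x \<in> cells K 1" "covered K a x" "covered K b x" "a \<noteq> b"
    and le: "\<And>y. \<bar>cobd K f $ y\<bar> \<le> 1" and f: "f $ b - f $ a = 1"
  shows "forman K x \<le> cobd_adj K (cobd K f) $ b - cobd_adj K (cobd K f) $ a"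
proof -
  have s: "cobd K f $ x = inc K b x" using cobd_edge[OF x] f by simp
  have "forman K x \<le> cobd K f $ x * hodge K (cobd K f) $ x"
    using le s x(3) by (intro forman_le_hodge) (auto simp: abs_inc)
  also have "hodge K (cobd K f) = cobd K (cobd_adj K (cobd K f))"
    by (simp add: hodge_def cobd_cobd linear_0[OF linear_cobd_adj])
  also have "cobd K f $ x * cobd K (cobd_adj K (cobd K f)) $ x
      = (inc K b x * inc K b x) * (cobd_adj K (cobd K f) $ b - cobd_adj K (cobd K f) $ a)"
    by (simp only: s cobd_edge[OF x, of "cobd_adj K (cobd K f)"] mult.assoc)
  finally show ?thesis
    using x(3) by (simp add: inc_mult_self)
qed

text \<open>Here \<open>a\<close> is the outer endpoint, where the other edges are deleted from
  \<delta>f. The factor \<open>cobd K f $ x * inc K b x\<close> is 1 if \<open>f\<close> increases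
  from \<open>a\<close> to \<open>b\<close> and -1 if it decreases, so the estimate serves both ends
  of a geodesic.\<close>

lemma forman_le_Deg_add:
  assumes x: "x \<in> cells K 1" "covered K a x" "covered K b x" "a \<noteq> b"
    and le: "\<And>y. \<bar>cobd K f $ y\<bar> \<le> 1" and one: "\<bar>cobd K f $ x\<bar> = 1"
  shows "forman K x \<le> cobd K f $ x * inc K b x * cobd_adj K (cobd K f) $ b + Deg K x"
proof -
  define U where "U = cobd_adj K (cobd K f)"
  define s where "s = cobd K f $ x"
  define \<psi> :: "real ^ 'a" where "\<psi> = (\<chi> y. if y \<noteq> x \<and> covered K a y then cobd K f $ y else 0)"
  define \<phi> where "\<phi> = cobd K f - \<psi>"
  have \<phi>x: "\<phi> $ x = s" by (simp add: \<phi>_def \<psi>_def s_def)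
  have "\<bar>\<phi> $ y\<bar> \<le> 1" for y using le[of y] by (simp add: \<phi>_def \<psi>_def)
  then have F: "forman K x \<le> s * hodge K \<phi> $ x"
    using forman_le_hodge[of \<phi> x] one unfolding \<phi>x s_def by simp
  have ss: "s * s = 1" using one by (metis abs_mult_self_eq mult_1 s_def)
  have \<phi>b: "cobd_adj K \<phi> $ b = U $ b"
    unfolding U_def cobd_adj_nth
  proof (rule sum.cong)
    fix y
    \<comment> \<open>The deletion is invisible at \<open>b\<close>: only \<open>x\<close> itself
      joins \<open>a\<close> to \<open>b\<close>.\<close>
    have "\<not> (y \<noteq> x \<and> covered K a y \<and> covered K b y)" using edge_unique[OF x] by blast
    then show "inc K b y * \<phi> $ y * (weight K y / weight K b)
        = inc K b y * cobd K f $ y * (weight K y / weight K b)"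
      by (auto simp: \<phi>_def \<psi>_def covered_def)
  qed simp
  have "cobd_adj K \<phi> $ a = (\<Sum>y\<in>{x}. inc K a y * \<phi> $ y * (weight K y / weight K a))"
    unfolding cobd_adj_nth
    by (rule sum.mono_neutral_right) (auto simp: \<phi>_def \<psi>_def covered_def)
  then have \<phi>a: "cobd_adj K \<phi> $ a = inc K a x * s * (weight K x / weight K a)"
    by (simp add: \<phi>x)
  \<comment> \<open>At \<open>a\<close> only \<open>x\<close> is left; the opposite signs of the
    endpoints and \<open>s * s = 1\<close> turn its contribution into a positive weight
    ratio.\<close>
  have down: "s * cobd K (cobd_adj K \<phi>) $ x = s * inc K b x * U $ b + weight K x / weight K a"
  proof -
    have "inc K b x * inc K a x = -1"
      using edge_ends(2)[OF x] inc_mult_self[of b x] x(3) by simp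
    then have "s * cobd K (cobd_adj K \<phi>) $ x = s * inc K b x * U $ b - (s * s) * (inc K b x * inc K a x) * (weight K x / weight K a)"
      by (simp only: cobd_edge[OF x] \<phi>a \<phi>b) (simp add: algebra_simps)
    then show ?thesis using ss \<open>inc K b x * inc K a x = -1\<close> by simp
  qed
  have "\<bar>cobd K \<phi> $ z\<bar> \<le> 1" if z: "covered K x z" for z
  proof -
    let ?P = "{y. covered K a y \<and> covered K y z}"
    \<comment> \<open>Since \<delta>\<delta>f = 0, only the deleted edges below \<open>z\<close>
      have to be estimated, not all its faces.\<close>
    have "cobd K \<phi> = - cobd K \<psi>"
      by (simp add: \<phi>_def linear_diff[OF linear_cobd] cobd_cobd)
    then have "\<bar>cobd K \<phi> $ z\<bar> = \<bar>\<Sum>y\<in>UNIV. \<psi> $ y * inc K y z\<bar>"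
      by (simp add: cobd_nth)
    also have "(\<Sum>y\<in>UNIV. \<psi> $ y * inc K y z) = (\<Sum>y\<in>?P - {x}. \<psi> $ y * inc K y z)"
      by (rule sum.mono_neutral_right) (auto simp: \<psi>_def covered_def)
    also have "\<bar>\<dots>\<bar> \<le> (\<Sum>y\<in>?P - {x}. \<bar>\<psi> $ y * inc K y z\<bar>)" by (rule sum_abs)
    also have "\<dots> \<le> (\<Sum>y\<in>?P - {x}. 1)"
      by (rule sum_mono) (use le in \<open>auto simp: abs_mult abs_inc \<psi>_def\<close>)
    \<comment> \<open>Exactly two edges at \<open>a\<close> lie below \<open>z\<close>, and one of
      them is \<open>x\<close>.\<close>
    also have "\<dots> = 1"
      using between_card(1)[OF x(2) z] x(2) z by (simp add: card_Diff_singleton)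
    finally show ?thesis .
  qed
  then have "\<bar>cobd_adj K (cobd K \<phi>) $ x\<bar> \<le> (\<Sum>z\<in>{z. covered K x z}. weight K z / weight K x)"
    by (rule abs_cobd_adj_le)
  then have "s * cobd_adj K (cobd K \<phi>) $ x \<le> (\<Sum>z\<in>{z. covered K x z}. weight K z / weight K x)"
    using one unfolding s_def[symmetric] by (metis abs_le_D1 abs_mult mult_1)
  with F down Deg_edge_ge[OF x(1,2)] show ?thesis
    by (simp add: hodge_def distrib_left U_def s_def)
qed

text \<open>This treats geodesics of length one, whose only edge is both first and last. The test
  function is the indicator of \<open>x\<close>: the diagonal entry of H is the sum of both endpoint
  weight ratios and the up-degree, and adding the two endpoint bounds for \<open>Deg K x\<close>
  covers it.\<close>

lemma forman_le_2_Deg: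
  assumes x: "x \<in> cells K 1" "covered K a x" "covered K b x" "a \<noteq> b"
  shows "forman K x \<le> 2 * Deg K x"
proof -
  have adj_ind: "cobd_adj K (cell_ind x) $ v = inc K v x * (weight K x / weight K v)" for v
  proof -
    have "cobd_adj K (cell_ind x) $ v
      = (\<Sum>z\<in>{x}. inc K v z * cell_ind x $ z * (weight K z / weight K v))"
      unfolding cobd_adj_nth by (rule sum.mono_neutral_right) (auto simp: axis_def)
    then show ?thesis by simp
  qed
  have "inc K b x * inc K b x = 1" "inc K b x * inc K a x = -1"
    using edge_ends(2)[OF x] inc_mult_self[of b x] x(3) by simp_all
  then have "cobd K (cobd_adj K (cell_ind x)) $ x = weight K x / weight K b + weight K x / weight K a"
    by (simp only: cobd_edge[OF x] adj_ind right_diff_distrib mult.assoc[symmetric])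
  moreover have "cobd_adj K (cobd K (cell_ind x)) $ x \<le> (\<Sum>z\<in>{z. covered K x z}. weight K z / weight K x)"
    by (rule abs_le_D1, rule abs_cobd_adj_le) (simp add: inc_def[symmetric] abs_inc)
  moreover have "forman K x \<le> hodge K (cell_ind x) $ x"
    using forman_le_hodge[of "cell_ind x" x] by (simp add: axis_def)
  ultimately show ?thesis
    using Deg_edge_ge[OF x(1,2)] Deg_edge_ge[OF x(1,3)] up_degree_nonneg[of x]
    by (simp add: hodge_def)
qed

section \<open>Geodesics\<close>

text \<open>A finite infimum rules out the empty set, whose infimum is \<infinity>, and a nonempty
  set in the well-order \<open>enat\<close> contains its infimum.\<close>

lemma path_dist_attained:
  assumes "path_dist K v w = enat n"
  obtains c where "c 0 = v" "c n = w" "\<forall>i\<le>n. c i \<in> cells K 0" "\<forall>i<n. adj K (c i) (c (Suc i))"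
proof -
  let ?S = "{enat n |n. \<exists>c :: nat \<Rightarrow> 'a. c 0 = v \<and> c n = w \<and>
     (\<forall>i\<le>n. c i \<in> cells K 0) \<and> (\<forall>i<n. adj K (c i) (c (Suc i)))}"
  have "?S \<noteq> {}"
    using assms unfolding path_dist_def by (auto simp: top_enat_def Inf_enat_def split: if_splits)
  then obtain k where "k \<in> ?S" by (meson ex_in_conv)
  then have "Inf ?S \<in> ?S" by (rule wellorder_InfI)
  then show ?thesis using assms that unfolding path_dist_def by auto
qed

lemma path_dist_le:
  assumes "c 0 = v" "c n = w" "\<forall>i\<le>n. c i \<in> cells K 0" "\<forall>i<n. adj K (c i) (c (Suc i))"
  shows "path_dist K v w \<le> enat n"
  unfolding path_dist_def by (rule Inf_lower) (use assms in blast)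

lemma path_dist_step:
  assumes "b \<in> cells K 0" "adj K a b"
  shows "path_dist K v b \<le> path_dist K v a + 1"
proof (cases "path_dist K v a")
  case (enat n)
  then obtain c where c: "c 0 = v" "c n = a" "\<forall>i\<le>n. c i \<in> cells K 0"
      "\<forall>i<n. adj K (c i) (c (Suc i))"
    by (rule path_dist_attained)
  have "path_dist K v b \<le> enat (Suc n)"
    by (rule path_dist_le[of "c(Suc n := b)"])
      (use c assms in \<open>auto simp: less_Suc_eq le_Suc_eq\<close>)
  then show ?thesis by (simp add: enat eSuc_enat[symmetric] plus_1_eSuc)
qed simp

lemma adj_sym: "adj K a b \<Longrightarrow> adj K b a"
  by (auto simp: adj_def)

text \<open>The cap keeps \<open>the_enat\<close> away from \<infinity> at vertices that no path
  joins to \<open>v\<close>. The value 0 on all other cells makes this a 0-cochain.\<close>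

definition capped_dist :: "'a \<Rightarrow> nat \<Rightarrow> real ^ 'a" where
  "capped_dist v n = (\<chi> a. if a \<in> cells K 0 then real (the_enat (min (path_dist K v a) (enat n))) else 0)"

lemma capped_dist_lipschitz:
  assumes "a \<in> cells K 0" "b \<in> cells K 0" "adj K a b"
  shows "\<bar>capped_dist v n $ b - capped_dist v n $ a\<bar> \<le> 1"
proof -
  have "path_dist K v b \<le> path_dist K v a + 1" "path_dist K v a \<le> path_dist K v b + 1"
    using path_dist_step assms adj_sym by blast+
  then show ?thesis using assms(1,2)
    by (cases "path_dist K v a"; cases "path_dist K v b")
      (auto simp: capped_dist_def min_def one_enat_def)
qed

text \<open>On edges this is the Lipschitz bound; on other cells the coboundary vanishes. All cells
  are included because \<open>forman_le_hodge\<close> asks for a bound everywhere.\<close>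

lemma abs_cobd_capped_dist: "\<bar>cobd K (capped_dist v n) $ x\<bar> \<le> 1"
proof (cases "x \<in> cells K 1")
  case False
  have "capped_dist v n $ a * inc K a x = 0" for a
    using covered_dim[of a x] False by (auto simp: capped_dist_def cells_def covered_def)
  then have "cobd K (capped_dist v n) $ x = 0"
    unfolding cobd_nth by (intro sum.neutral) blast
  then show ?thesis by simp
next
  case True
  obtain a b where ab: "a \<in> cells K 0" "inc K a x = 1" "b \<in> cells K 0" "inc K b x = -1"
    using edge_oriented[OF True] by blast
  then have cov: "covered K a x" "covered K b x" "a \<noteq> b" by (auto simp: covered_def)
  have "\<bar>capped_dist v n $ b - capped_dist v n $ a\<bar> \<le> 1"
    using ab cov True by (intro capped_dist_lipschitz) (auto simp: adj_def)
  then show ?thesis using cobd_edge[OF True cov] ab by simp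
qed

section \<open>Diameter bounds\<close>

lemma Deg_le_maxDeg: "x \<in> cells K k \<Longrightarrow> Deg K x \<le> maxDeg K k"
  by (auto simp: maxDeg_def)

text \<open>For distance 0 there may be no edge at all, and then the default value 0 of
  \<open>maxDeg\<close> is what is compared.\<close>

lemma maxDeg_nonneg: "k \<le> 1 \<Longrightarrow> 0 \<le> maxDeg K k"
proof (cases "cells K k = {}")
  case True
  then show ?thesis by (simp add: maxDeg_def)
next
  case False
  assume k: "k \<le> 1"
  from False obtain x where x: "x \<in> cells K k" by blast
  have "0 \<le> Deg K x"
  proof (cases "k = 0")
    case True
    then show ?thesis using x Deg_vertex up_degree_nonneg by simp
  next
    case False
    then have x1: "x \<in> cells K 1" using k x by (simp add: le_Suc_eq)
    then obtain a where "covered K a x"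
      using K unfolding cell_complex_def cells_def by (metis (mono_tags) mem_Collect_eq order_refl)
    from Deg_edge_ge[OF x1 this] show ?thesis
      using up_degree_nonneg[of x] weight_pos[of x] weight_pos[of a]
      by (meson add_nonneg_nonneg divide_nonneg_nonneg less_imp_le order_trans)
  qed
  then show ?thesis using Deg_le_maxDeg[OF x] by linarith
qed

lemma path_dist_bound:
  assumes R: "\<forall>x\<in>cells K 1. forman K x \<ge> R"
    and L: "path_dist K v w = enat L"
  shows "R * real L \<le> 2 * maxDeg K 0" and "R * real L \<le> 2 * maxDeg K 1"
proof -
  obtain c where c: "c 0 = v" "c L = w" "\<forall>i\<le>L. c i \<in> cells K 0"
      "\<forall>i<L. adj K (c i) (c (Suc i))"
    using L by (rule path_dist_attained)
  define f where "f = capped_dist v L"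
  have le: "\<bar>cobd K f $ y\<bar> \<le> 1" for y unfolding f_def by (rule abs_cobd_capped_dist)
  have lip: "\<bar>f $ c (Suc i) - f $ c i\<bar> \<le> 1" if "i < L" for i
    using c that unfolding f_def by (intro capped_dist_lipschitz) auto
  have "path_dist K v v \<le> enat 0"
    by (rule path_dist_le[of "\<lambda>_. v"]) (use c in auto)
  then have "path_dist K v v = enat 0" by (simp add: zero_enat_def[symmetric])
  then have f0: "f $ c 0 = 0"
    using c(1) by (simp add: f_def capped_dist_def)
  have fL: "f $ c L = real L"
    using c(2,3) L by (auto simp: f_def capped_dist_def)
  \<comment> \<open>A function with steps of size at most 1 that climbs from 0 to \<open>L\<close>
    in \<open>L\<close> steps must climb by exactly 1 each time: bound it above from the start and
    below from the end.\<close>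
  have upper: "f $ c i \<le> real i" if "i \<le> L" for i
    using that
  proof (induction i)
    case (Suc i)
    then show ?case using lip[of i] by simp
  qed (simp add: f0)
  have lower: "real i \<le> f $ c i" if "i \<le> L" for i
    using that
  proof (induction rule: inc_induct)
    case (step i)
    then show ?case using lip[of i] by simp
  qed (simp add: fL)
  have grow: "f $ c (Suc i) - f $ c i = 1" if "i < L" for i
    using upper[of i] lower[of i] upper[of "Suc i"] lower[of "Suc i"] that by simp
  have "\<forall>i. \<exists>x. i < L \<longrightarrow> x \<in> cells K 1 \<and> covered K (c i) x \<and> covered K (c (Suc i)) x"
    using c(4) by (auto simp: adj_def)
  then obtain e where e: "\<And>i. i < L \<Longrightarrow> e i \<in> cells K 1 \<and> covered K (c i) (e i) \<and> covered K (c (Suc i)) (e i)"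
    by metis
  have edge: "e i \<in> cells K 1" "covered K (c i) (e i)" "covered K (c (Suc i)) (e i)" "c i \<noteq> c (Suc i)"
    if "i < L" for i
    using e[OF that] grow[OF that] by auto
  define u where "u i = cobd_adj K (cobd K f) $ c i" for i
  have step: "R \<le> u (Suc i) - u i" if "i < L" for i
    using forman_le_cobd_laplacian[OF edge[OF that] le grow[OF that]] R edge(1)[OF that]
    unfolding u_def by force
  \<comment> \<open>Arbitrary limits are allowed because the bound by \<open>maxDeg K 1\<close> sums
    over the interior edges only.\<close>
  have tele: "R * (real n - real m) \<le> u n - u m" if "m \<le> n" "n \<le> L" for m n
    using that
  proof (induction n rule: dec_induct)
    case (step n)
    then show ?case using \<open>\<And>i. i < L \<Longrightarrow> R \<le> u (Suc i) - u i\<close>[of n] by (simp add: algebra_simps)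
  qed simp
  have u_bound: "\<bar>u i\<bar> \<le> maxDeg K 0" if "i \<le> L" for i
  proof -
    have ci: "c i \<in> cells K 0" using c(3) that by blast
    have "\<bar>u i\<bar> \<le> Deg K (c i)"
      unfolding u_def Deg_vertex[OF ci] by (rule abs_cobd_adj_le) (rule le)
    then show ?thesis using Deg_le_maxDeg[OF ci] by linarith
  qed
  show "R * real L \<le> 2 * maxDeg K 0"
    using tele[of 0 L] u_bound[of 0] u_bound[of L] by simp
  \<comment> \<open>The endpoint estimates are applied to the first and the last edge, which are
    distinct only for \<open>L \<ge> 2\<close>.\<close>
  consider "L = 0" | "L = 1" | "L \<ge> 2" by linarith
  then show "R * real L \<le> 2 * maxDeg K 1"
  proof cases
    case 1
    then show ?thesis using maxDeg_nonneg[of 1] by simp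
  next
    case 2
    then have "0 < L" by simp
    note x = edge[OF this]
    have "R \<le> 2 * Deg K (e 0)" using forman_le_2_Deg[OF x] R x(1) by fastforce
    then show ?thesis using Deg_le_maxDeg[OF x(1)] 2 by simp
  next
    case 3
    then obtain l where l: "L = Suc l" "1 \<le> l" by (cases L) auto
    have "0 < L" "l < L" using l by simp_all
    have \<delta>f: "cobd K f $ e i = inc K (c (Suc i)) (e i)" "\<bar>cobd K f $ e i\<bar> = 1" if "i < L" for i
      using cobd_edge[OF edge[OF that]] grow[OF that] edge(3)[OF that] by (simp_all add: abs_inc)
    have sq: "inc K (c (Suc i)) (e i) * inc K (c (Suc i)) (e i) = 1"
         "inc K (c (Suc i)) (e i) * inc K (c i) (e i) = -1" if "i < L" for i
      using edge[OF that] edge_ends(2)[OF edge[OF that]] inc_mult_self[of "c (Suc i)" "e i"] by simp_all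
    have "forman K (e 0) \<le> u 1 + Deg K (e 0)"
      using forman_le_Deg_add[OF edge[OF \<open>0 < L\<close>] le \<delta>f(2)[OF \<open>0 < L\<close>]]
      unfolding \<delta>f(1)[OF \<open>0 < L\<close>] sq[OF \<open>0 < L\<close>] u_def by simp
    \<comment> \<open>The endpoints are swapped: the outer vertex is now \<open>c L\<close>, and
      \<open>f\<close> decreases towards the inner one, whence the minus sign.\<close>
    moreover have "forman K (e l) \<le> - u l + Deg K (e l)"
      using forman_le_Deg_add[OF edge(1,3,2)[OF \<open>l < L\<close>] edge(4)[OF \<open>l < L\<close>, symmetric] le \<delta>f(2)[OF \<open>l < L\<close>]]
      unfolding \<delta>f(1)[OF \<open>l < L\<close>] sq[OF \<open>l < L\<close>] u_def by simp
    moreover have "R \<le> forman K (e 0)" "R \<le> forman K (e l)"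
      using R edge(1) \<open>0 < L\<close> \<open>l < L\<close> by blast+
    moreover have "Deg K (e 0) \<le> maxDeg K 1" "Deg K (e l) \<le> maxDeg K 1"
      using edge(1) \<open>0 < L\<close> \<open>l < L\<close> Deg_le_maxDeg by blast+
    \<comment> \<open>The \<open>L - 2\<close> interior edges give \<open>R * (L - 2)\<close>; the
      two end edges supply the missing \<open>2 * R\<close> and cancel \<open>u 1\<close> and
      \<open>u l\<close>.\<close>
    moreover have "R * (real l - real 1) \<le> u l - u 1" using tele[of 1 l] l by simp
    ultimately show ?thesis using l(1) by (simp add: algebra_simps)
  qed
qed

end

text \<open>Two isolated vertices satisfy the assumptions and have infinite distance, so the
  diameter is bounded for connected complexes; the second conjunct bounds distances within each
  component.\<close>

theorem theorem6p3:
  fixes K :: "'a :: finite cell_data" and R :: real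
  assumes "cell_complex K"
    and "R > 0"
    and "\<forall>x\<in>cells K 1. forman K x \<ge> R"
  shows "((\<forall>v\<in>cells K 0. \<forall>w\<in>cells K 0. path_dist K v w < \<infinity>) \<longrightarrow>
            ereal_of_enat (diam K) \<le> ereal (2 * min (maxDeg K 1) (maxDeg K 0) / R)) \<and>
         (\<forall>v\<in>cells K 0. \<forall>w\<in>cells K 0. path_dist K v w < \<infinity> \<longrightarrow>
            ereal_of_enat (path_dist K v w) \<le> ereal (2 * min (maxDeg K 1) (maxDeg K 0) / R))"
proof -
  have bound: "ereal_of_enat (path_dist K v w) \<le> ereal (2 * min (maxDeg K 1) (maxDeg K 0) / R)"
    if "path_dist K v w < \<infinity>" for v w
  proof -
    from that obtain L where L: "path_dist K v w = enat L" by (cases "path_dist K v w") auto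
    have "R * real L \<le> 2 * min (maxDeg K 1) (maxDeg K 0)"
      using path_dist_bound[OF assms(1,3) L] by (simp add: min_def)
    then show ?thesis using assms(2) by (simp add: L field_simps)
  qed
  let ?D = "{path_dist K v w |v w. v \<in> cells K 0 \<and> w \<in> cells K 0}"
  have "?D = (\<lambda>(v, w). path_dist K v w) ` (cells K 0 \<times> cells K 0)" by auto
  then have "finite ?D" "?D \<noteq> {}" using vertex_exists[OF assms(1)] by auto
  \<comment> \<open>The maximum is attained, so the diameter is itself the distance of some pair and
    the pairwise bound applies to it.\<close>
  then have "diam K \<in> ?D" unfolding diam_def by (rule Max_in)
  then show ?thesis using bound by auto
qed

end
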